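(* Let $p$ be a prime, $q=p^{r}$, $k\geq 3$ with $k\mid(q-1)$, $m=(q-1)/k$, $F=\mathrm{GF}(q)$, $\zeta$ a generator of $F^{*}$, $\varphi=\zeta^{m}$, and $\Phi=\langle\varphi\rangle$ the subgroup of order $k$. For $a\in F^{*}$, $c\in F$ let $[a,c]_{k}=|\Phi\cap(\Phi a+c)|$, and for $i,j\in\{1,\dots,k-1\}$ let $c_{j,i}=(\varphi^{j}-1)^{-1}(\varphi^{i}-1)$, indices read modulo $k$ and represented in $\{0,\dots,k-1\}$. Suppose $(p,k)$ is circular, and let $a,c\in F$ with $a\neq 0$. Then $[a,c]_{k}=2$ if and only if $a\in\Phi c_{j,i}$ and $c\in\Phi c_{j,j-i}$ for some $i,j\in\{1,\dots,k-1\}$ with $i\neq j$.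
   Context: For a finite field $E$ and its multiplicative subgroup $\Psi$ of order $k$, the pair $(E,\Psi)$ is circular if $|\Psi a\cap(\Psi b+c)|\leq 2$ for all $a,b,c\in E^{*}$. The pair $(p,k)$ is called circular if $(\mathrm{GF}(p^{r'}),\Psi)$ is circular for some $r'\in\mathbb{N}$ with $k\mid(p^{r'}-1)$; it is known (Modisett) that then $(\mathrm{GF}(p^{r}),\Phi)$ is circular for every $r$ with $k\mid(p^{r}-1)$. *)

theory Defs
  imports "HOL-Algebra.Multiplicative_Group" "HOL-Algebra.Generated_Groups" "HOL-Computational_Algebra.Primes"
begin

definition circular :: "('a, 'b) ring_scheme \<Rightarrow> 'a set \<Rightarrow> bool" where
  "circular E \<Psi> \<longleftrightarrow>
     (\<forall>a \<in> carrier E - {\<zero>\<^bsub>E\<^esub>}. \<forall>b \<in> carrier E - {\<zero>\<^bsub>E\<^esub>}. \<forall>c \<in> carrier E - {\<zero>\<^bsub>E\<^esub>}.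
        card ((\<Psi> #>\<^bsub>E\<^esub> a) \<inter> ((\<Psi> #>\<^bsub>E\<^esub> b) +>\<^bsub>E\<^esub> c)) \<le> 2)"

text \<open>
  The fields in the next definition have carriers among the natural numbers. This is no restriction:
  every finite field has an isomorphic copy there, and circularity is invariant under isomorphism.
  Since the unit group is cyclic, there is exactly one subgroup of order \<open>k\<close>.
\<close>

definition circular_pair :: "nat \<Rightarrow> nat \<Rightarrow> bool" where
  "circular_pair p k \<longleftrightarrow>
     (\<exists>(r'::nat) (E :: nat ring) \<Psi>.
        k dvd (p ^ r' - 1) \<and> field E \<and> card (carrier E) = p ^ r' \<and>
        subgroup \<Psi> (mult_of E) \<and> card \<Psi> = k \<and> circular E \<Psi>)"

definition inter_number :: "('a, 'b) ring_scheme \<Rightarrow> 'a set \<Rightarrow> 'a \<Rightarrow> 'a \<Rightarrow> nat" where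
  "inter_number F \<Phi> a c = card (\<Phi> \<inter> ((\<Phi> #>\<^bsub>F\<^esub> a) +>\<^bsub>F\<^esub> c))"

text \<open>The indices are integers, read modulo \<open>k\<close>, so that the index \<open>j - i\<close> is not truncated.\<close>

definition c_elem :: "('a, 'b) ring_scheme \<Rightarrow> nat \<Rightarrow> 'a \<Rightarrow> int \<Rightarrow> int \<Rightarrow> 'a" where
  "c_elem F k \<phi> j i =
     inv\<^bsub>F\<^esub> (\<phi> [^]\<^bsub>F\<^esub> nat (j mod int k) \<ominus>\<^bsub>F\<^esub> \<one>\<^bsub>F\<^esub>)
       \<otimes>\<^bsub>F\<^esub> (\<phi> [^]\<^bsub>F\<^esub> nat (i mod int k) \<ominus>\<^bsub>F\<^esub> \<one>\<^bsub>F\<^esub>)"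

end

theory Submission
  imports Defs "HOL-Computational_Algebra.Polynomial"
begin

text \<open>
  If \<open>t = v a + c\<close> and \<open>X t = Y v a + c\<close> with \<open>t, v, X, Y \<in> \<Phi>\<close>, then
  \<open>v a (Y - 1) = t (X - 1)\<close> and \<open>c (Y - 1) = t (Y - X)\<close>, and conversely. With \<open>X = \<phi>\<^sup>i\<close> and
  \<open>Y = \<phi>\<^sup>j\<close> this says that two points of \<open>\<Phi> \<inter> (\<Phi> a + c)\<close> amount to \<open>a \<in> \<Phi> c\<^sub>j\<^sub>,\<^sub>i\<close> and
  \<open>c \<in> \<Phi> c\<^sub>j\<^sub>,\<^sub>j\<^sub>-\<^sub>i\<close>. Circularity excludes a third point.

  Circularity is given for some field \<open>E\<close> of characteristic \<open>p\<close> and has to be moved to \<open>F\<close>. The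
  integer polynomials vanishing at \<open>\<phi>\<close> form the ideal generated by \<open>p\<close> and a monic \<open>f\<close> of least
  degree. Modulo \<open>p\<close>, \<open>f\<close> divides \<open>X\<^sup>k - 1\<close>, which has \<open>k\<close> roots in \<open>\<Psi> \<subseteq> E\<close>; the cofactor has
  fewer than \<open>k\<close>, so \<open>f\<close> has a root \<open>y \<in> \<Psi>\<close>. By minimality of \<open>f\<close> the same polynomials vanish at
  \<open>y\<close> and at \<open>\<phi>\<close>. Three points in \<open>F\<close> give the relation
  \<open>(\<phi>\<^sup>i - 1) (\<phi>\<^sup>j\<^sup>' - 1) = (\<phi>\<^sup>i\<^sup>' - 1) (\<phi>\<^sup>j - 1)\<close>, and the same relation for \<open>y\<close> puts
  \<open>1, y\<^sup>i, y\<^sup>i\<^sup>'\<close> into \<open>\<Psi> \<inter> (\<Psi> b + (1 - b))\<close> with \<open>b = (y\<^sup>i - 1) / (y\<^sup>j - 1)\<close>.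
\<close>

section \<open>Evaluation of integer polynomials in a commutative ring\<close>

text \<open>Horner evaluation, with the integers mapped into the ring as multiples of one.
  Coefficients stay in the integers so that one and the same polynomial can be evaluated both in
  \<open>F\<close> and in \<open>E\<close>, which have different carrier types.\<close>

definition ipoly_eval :: "('a, 'b) ring_scheme \<Rightarrow> 'a \<Rightarrow> int poly \<Rightarrow> 'a" where
  "ipoly_eval R x P =
     fold_coeffs (\<lambda>a b. [a] \<cdot>\<^bsub>R\<^esub> \<one>\<^bsub>R\<^esub> \<oplus>\<^bsub>R\<^esub> x \<otimes>\<^bsub>R\<^esub> b) P \<zero>\<^bsub>R\<^esub>"

context cring
begin

lemma int_zero_one [simp]: "[(0::int)] \<cdot> \<one> = \<zero>"
  by (simp add: add_pow_def)

text \<open>Together with \<open>int_add_one\<close> this makes the passage from integers to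
  multiples of one a ring homomorphism, which is what makes evaluation additive and
  multiplicative.\<close>

lemma int_mult_one: "[(a * b)] \<cdot> \<one> = ([a] \<cdot> \<one>) \<otimes> ([(b::int)] \<cdot> \<one>)"
proof -
  have "([a] \<cdot> \<one>) \<otimes> ([b] \<cdot> \<one>) = [a] \<cdot> (\<one> \<otimes> ([b] \<cdot> \<one>))"
    by (intro add_pow_ldistr_int) auto
  also have "\<dots> = [a] \<cdot> ([b] \<cdot> \<one>)" by simp
  also have "\<dots> = [(a * b)] \<cdot> \<one>"
    using add.int_pow_pow[of \<one> a b] by (simp add: mult.commute add_pow_def)
  finally show ?thesis ..
qed

lemma int_add_one: "[(a + b)] \<cdot> \<one> = ([a] \<cdot> \<one>) \<oplus> ([(b::int)] \<cdot> \<one>)"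
  using add.int_pow_mult[of \<one> a b] by (simp add: add_pow_def)

lemma ipoly_eval_0 [simp]: "ipoly_eval R x 0 = \<zero>"
  by (simp add: ipoly_eval_def)

lemma ipoly_eval_pCons:
  assumes "x \<in> carrier R"
  shows "ipoly_eval R x (pCons a P) = [a] \<cdot> \<one> \<oplus> x \<otimes> ipoly_eval R x P"
  \<comment> \<open>\<open>pCons 0 0\<close> is the zero polynomial, on which the fold does no step;
    both sides are then zero.\<close>
  using assms by (cases "P = 0 \<and> a = 0") (auto simp: ipoly_eval_def)

lemma ipoly_eval_closed [simp, intro]:
  assumes "x \<in> carrier R"
  shows "ipoly_eval R x P \<in> carrier R"
  by (induction P) (use assms in \<open>auto simp: ipoly_eval_pCons\<close>)

lemma ipoly_eval_1 [simp]:
  assumes "x \<in> carrier R"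
  shows "ipoly_eval R x 1 = \<one>"
  using assms ipoly_eval_pCons[of x 1 0] by (simp add: pCons_one)

lemma ipoly_eval_add:
  assumes "x \<in> carrier R"
  shows "ipoly_eval R x (P + Q) = ipoly_eval R x P \<oplus> ipoly_eval R x Q"
proof (induction P Q rule: poly_induct2)
  case (pCons a P b Q)
  then show ?case
    using assms by (simp add: ipoly_eval_pCons int_add_one r_distr a_ac)
qed simp

lemma ipoly_eval_smult:
  assumes "x \<in> carrier R"
  shows "ipoly_eval R x (smult a P) = ([a] \<cdot> \<one>) \<otimes> ipoly_eval R x P"
  by (induction P) (use assms in \<open>auto simp: ipoly_eval_pCons int_mult_one r_distr m_ac\<close>)

lemma ipoly_eval_mult:
  assumes "x \<in> carrier R"
  shows "ipoly_eval R x (P * Q) = ipoly_eval R x P \<otimes> ipoly_eval R x Q"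
proof (induction P)
  case (pCons a P)
  then show ?case
    using assms
    by (simp add: ipoly_eval_pCons ipoly_eval_add ipoly_eval_smult l_distr m_assoc)
qed (use assms in auto)

lemma ipoly_eval_minus:
  assumes "x \<in> carrier R"
  shows "ipoly_eval R x (- P) = \<ominus> ipoly_eval R x P"
  by (metis assms ipoly_eval_add ipoly_eval_closed ipoly_eval_0 add.inv_equality add.left_inverse)

lemma ipoly_eval_diff:
  assumes "x \<in> carrier R"
  shows "ipoly_eval R x (P - Q) = ipoly_eval R x P \<ominus> ipoly_eval R x Q"
  using ipoly_eval_add[OF assms, of P "- Q"] by (simp add: assms ipoly_eval_minus a_minus_def)

lemma ipoly_eval_monom:
  assumes "x \<in> carrier R"
  shows "ipoly_eval R x (Polynomial.monom 1 n) = x [^] n"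
  by (induction n) (use assms in \<open>auto simp: monom_Suc ipoly_eval_pCons m_comm monom_0\<close>)

text \<open>Connects the Horner form with the power sum by which \<open>UnivPoly\<close> evaluates;
  needed only for counting roots.\<close>

lemma ipoly_eval_finsum:
  assumes "x \<in> carrier R" "degree P \<le> n"
  shows "ipoly_eval R x P = (\<Oplus>i\<in>{..n}. ([(Polynomial.coeff P i)] \<cdot> \<one>) \<otimes> x [^] i)"
  using assms(2)
proof (induction P arbitrary: n)
  case 0
  then show ?case using assms(1) by simp
next
  case (pCons a P)
  show ?case
  proof (cases n)
    case 0
    then show ?thesis using pCons assms(1) by (simp add: ipoly_eval_pCons split: if_splits)
  next
    case (Suc m)
    with pCons.prems have "degree P \<le> m" by (auto split: if_splits)
    note IH = pCons.IH[OF this]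
    have "(\<Oplus>i\<in>{..n}. ([(Polynomial.coeff (pCons a P) i)] \<cdot> \<one>) \<otimes> x [^] i) =
        (\<Oplus>i\<in>{..m}. ([(Polynomial.coeff P i)] \<cdot> \<one>) \<otimes> x [^] Suc i) \<oplus> [a] \<cdot> \<one>"
      \<comment> \<open>The term of index 0 is split off, so that every remaining power contains a
        factor \<open>x\<close>.\<close>
      unfolding Suc using assms(1) by (subst finsum_Suc2) auto
    also have "(\<Oplus>i\<in>{..m}. ([(Polynomial.coeff P i)] \<cdot> \<one>) \<otimes> x [^] Suc i) =
        (\<Oplus>i\<in>{..m}. x \<otimes> (([(Polynomial.coeff P i)] \<cdot> \<one>) \<otimes> x [^] i))"
      by (intro finsum_cong') (use assms(1) in \<open>auto simp: m_ac\<close>)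
    also have "\<dots> = x \<otimes> ipoly_eval R x P"
      unfolding IH by (rule finsum_rdistr[symmetric]) (use assms(1) in auto)
    finally show ?thesis using assms(1) by (simp add: ipoly_eval_pCons a_comm)
  qed
qed

end

section \<open>Root counting, and the ideal of integer polynomials vanishing at a point\<close>

text \<open>The coefficients of \<open>P\<close>, mapped into the ring, form an element
  \<open>f\<close> of \<open>UP R\<close>, to which the root bound over a domain applies.\<close>

lemma (in domain) card_roots_ipoly_eval_le:
  assumes "finite (carrier R)" "lead_coeff P = 1"
  shows "card {x \<in> carrier R. ipoly_eval R x P = \<zero>} \<le> degree P"
proof -
  note ev = ipoly_eval_finsum
  define U where "U = UP R"
  interpret UP_domain R U by unfold_locales (simp add: U_def)
  define f where "f i = [(Polynomial.coeff P i)] \<cdot> \<one>" for i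
  have f: "f \<in> up R"
    by (rule mem_upI) (auto simp: f_def bound_def coeff_eq_0 intro!: exI[of _ "degree P"])
  then have fU: "f \<in> carrier U" by (simp add: U_def UP_def)
  have cf: "UnivPoly.coeff U f = f" using f by (simp add: U_def UP_def)
  have deg: "deg R f = degree P"
  proof (rule antisym)
    show "deg R f \<le> degree P"
      by (rule deg_aboveI) (auto simp: fU cf f_def coeff_eq_0)
    \<comment> \<open>Monicity enters here: the leading coefficient becomes one, which is nonzero,
      so no degree is lost on reduction to the ring.\<close>
    show "degree P \<le> deg R f"
      by (rule deg_belowI) (auto simp: fU cf f_def assms)
  qed
  have f0: "f \<noteq> \<zero>\<^bsub>U\<^esub>"
  proof
    assume "f = \<zero>\<^bsub>U\<^esub>"
    then have "f (degree P) = \<zero>" by (simp add: U_def UP_def)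
    then show False by (simp add: f_def assms)
  qed
  have "eval R R id x f = ipoly_eval R x P" if "x \<in> carrier R" for x
    using that by (simp add: eval_on_carrier fU deg cf ev[OF that order.refl] f_def)
  then have "{x \<in> carrier R. eval R R id x f = \<zero>} = {x \<in> carrier R. ipoly_eval R x P = \<zero>}"
    by auto
  with roots_bound[OF fU f0 assms(1)] deg show ?thesis by simp
qed

text \<open>If \<open>p\<close> does not divide the leading coefficient of \<open>P\<close>, Bezout
  turns \<open>P\<close> into a monic annihilator of the same degree, below the minimum
  \<open>d\<close>. So \<open>p\<close> divides it, and the leading term can be stripped off by
  induction.\<close>

lemma (in cring) ipoly_eval_kernel_small_degree:
  assumes x: "x \<in> carrier R" and p: "Factorial_Ring.prime p" "[int p] \<cdot> \<one> = \<zero>"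
    and minimal: "\<And>g. lead_coeff g = 1 \<Longrightarrow> ipoly_eval R x g = \<zero> \<Longrightarrow> d \<le> degree g"
    and P: "ipoly_eval R x P = \<zero>" "degree P < d"
  shows "\<exists>S. P = smult (int p) S"
  using P
proof (induction "degree P" arbitrary: P rule: less_induct)
  case less
  define n where "n = degree P"
  define l where "l = lead_coeff P"
  \<comment> \<open>Monomials with coefficient divisible by \<open>p\<close> vanish at
    \<open>x\<close>, so they may be added or subtracted freely.\<close>
  have mono: "ipoly_eval R x (Polynomial.monom (int p * t) n) = \<zero>" for t
  proof -
    have "Polynomial.monom (int p * t) n = smult (int p) (Polynomial.monom t n)"
      by (simp add: smult_monom)
    then show ?thesis using x p by (simp add: ipoly_eval_smult)
  qed
  show ?case
  proof (cases "int p dvd l")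
    case True
    then obtain t where t: "l = int p * t" by auto
    define P' where "P' = P - Polynomial.monom (int p * t) n"
    have ev: "ipoly_eval R x P' = \<zero>"
      using x less.prems mono by (simp add: P'_def ipoly_eval_diff a_minus_def)
    have P: "P = P' + smult (int p) (Polynomial.monom t n)"
      by (simp add: P'_def smult_monom)
    \<comment> \<open>In degree 0 the degree cannot drop further, but there stripping leaves the
      zero polynomial.\<close>
    show ?thesis
    proof (cases "n = 0")
      case True
      have "P' = 0"
        using True t unfolding P'_def n_def l_def
        by (metis degree_0_id coeff_diff diff_self monom_0 right_minus_eq)
      then show ?thesis using P by auto
    next
      case False
      have "degree P' \<le> n"
        unfolding P'_def by (rule degree_diff_le) (auto simp: n_def degree_monom_le)
      moreover have "Polynomial.coeff P' n = 0"
        using t by (simp add: P'_def n_def l_def)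
      ultimately have "degree P' < n"
        using False by (metis coeff_0_degree_minus_1 degree_0 le_neq_implies_less leading_coeff_0_iff neq0_conv)
      then have "\<exists>S. P' = smult (int p) S"
        using less ev n_def by auto
      then show ?thesis using P by (metis smult_add_right)
    qed
  next
    case False
    have "coprime (int p) l"
      using False p(1) by (simp add: prime_imp_coprime)
    then obtain u v where uv: "u * l + v * int p = 1"
      by (metis coprime_commute bezout_int coprime_iff_gcd_eq_1)
    \<comment> \<open>The Bezout coefficients are chosen so that the coefficient at \<open>n\<close>
      is \<open>u * l + v * p = 1\<close>.\<close>
    define P' where "P' = smult u P + Polynomial.monom (int p * v) n"
    have "Polynomial.coeff P' n = 1"
      using uv by (simp add: P'_def n_def l_def mult.commute)
    moreover have "degree P' \<le> n"
      unfolding P'_def by (rule degree_add_le) (auto simp: n_def degree_monom_le)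
    ultimately have "degree P' = n" "lead_coeff P' = 1"
      by (metis le_antisym le_degree zero_neq_one)+
    moreover have "ipoly_eval R x P' = \<zero>"
      using x less.prems mono by (simp add: P'_def ipoly_eval_add ipoly_eval_smult)
    ultimately have "d \<le> n" using minimal by metis
    with less.prems show ?thesis by (simp add: n_def)
  qed
qed

lemma monic_int_poly_division:
  fixes f P :: "int poly"
  assumes "lead_coeff f = 1"
  obtains Q S where "P = f * Q + S" "S = 0 \<or> degree S < degree f"
proof -
  have "f \<noteq> 0" using assms by auto
  obtain Q S where QS: "pseudo_divmod P f = (Q, S)" by fastforce
  \<comment> \<open>Pseudo-division scales \<open>P\<close> by a power of the leading coefficient of
    \<open>f\<close>, which is 1 here.\<close>
  from pseudo_divmod[OF \<open>f \<noteq> 0\<close> QS] assms show ?thesis by (intro that[of Q S]) auto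
qed

text \<open>The remainder \<open>S\<close> has degree below that of \<open>f\<close>, so it cannot
  touch the top coefficient of \<open>f * g\<close>. That \<open>g\<close> is nonzero follows from
  \<open>le\<close>, since otherwise \<open>h = S\<close> would be too small.\<close>

lemma monic_cofactor:
  fixes f g h :: "int poly"
  assumes f: "lead_coeff f = 1" and h: "lead_coeff h = 1" "h = f * g + S"
    and S: "S = 0 \<or> degree S < degree f" and le: "degree f \<le> degree h"
  shows "lead_coeff g = 1" "degree h = degree f + degree g"
proof -
  have g: "g \<noteq> 0" using assms by auto
  have deg: "degree (f * g) = degree f + degree g"
    using f g by (intro degree_mult_eq) auto
  show deg_h: "degree h = degree f + degree g"
    using S deg h(2) by (auto simp: degree_add_eq_left)
  have "Polynomial.coeff S (degree f + degree g) = 0"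
    using S by (auto intro: coeff_eq_0)
  then have "lead_coeff h = lead_coeff (f * g)"
    using deg deg_h h(2) by simp
  then show "lead_coeff g = 1" using f h(1) by (simp add: lead_coeff_mult)
qed

text \<open>The remainder of \<open>P\<close> on division by \<open>f\<close> also vanishes at
  \<open>x\<close> and has small degree, so it is a multiple of \<open>p\<close>. Its degree bound
  is kept in the conclusion because \<open>monic_cofactor\<close> asks for it.\<close>

lemma (in cring) ipoly_eval_kernel:
  assumes x: "x \<in> carrier R" and p: "Factorial_Ring.prime p" "[int p] \<cdot> \<one> = \<zero>"
    and f: "lead_coeff f = 1" "ipoly_eval R x f = \<zero>"
    and minimal: "\<And>g. lead_coeff g = 1 \<Longrightarrow> ipoly_eval R x g = \<zero> \<Longrightarrow> degree f \<le> degree g"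
    and P: "ipoly_eval R x P = \<zero>"
  obtains Q S where "P = f * Q + smult (int p) S" "smult (int p) S = 0 \<or> degree (smult (int p) S) < degree f"
proof -
  obtain Q T where QT: "P = f * Q + T" "T = 0 \<or> degree T < degree f"
    using monic_int_poly_division[OF f(1)] by blast
  have "ipoly_eval R x T = \<zero>"
    using P x f unfolding QT by (simp add: ipoly_eval_add ipoly_eval_mult)
  then have "\<exists>S. T = smult (int p) S"
    using QT(2) ipoly_eval_kernel_small_degree[OF x p minimal] by (metis smult_0_right)
  then obtain S where "T = smult (int p) S" by blast
  then show thesis using QT by (intro that[of Q S]) auto
qed

lemma (in cring) minimal_monic_annihilator:
  assumes "lead_coeff h = 1" "ipoly_eval R x h = \<zero>"
  obtains f where "lead_coeff f = 1" "ipoly_eval R x f = \<zero>" "degree f \<le> degree h"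
    "\<And>g. lead_coeff g = 1 \<Longrightarrow> ipoly_eval R x g = \<zero> \<Longrightarrow> degree f \<le> degree g"
  using ex_has_least_nat[of "\<lambda>f. lead_coeff f = 1 \<and> ipoly_eval R x f = \<zero>" h degree] assms
  by blast

lemma lead_coeff_pow_minus_1:
  assumes "k > 0"
  shows "lead_coeff (Polynomial.monom 1 k - 1 :: int poly) = 1" "degree (Polynomial.monom 1 k - 1 :: int poly) = k"
proof -
  have "degree (Polynomial.monom 1 k + (- 1) :: int poly) = k"
    using assms by (subst degree_add_eq_left) (auto simp: degree_monom_eq)
  then show *: "degree (Polynomial.monom 1 k - 1 :: int poly) = k" by simp
  show "lead_coeff (Polynomial.monom 1 k - 1 :: int poly) = 1"
    unfolding * using assms by (simp add: coeff_1)
qed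

section \<open>Conjugate roots of unity in two domains of the same characteristic\<close>

lemma conjugate_root_of_unity:
  assumes "domain F" "domain E" and finE: "finite (carrier E)" and p: "Factorial_Ring.prime p"
    and pF: "[int p] \<cdot>\<^bsub>F\<^esub> \<one>\<^bsub>F\<^esub> = \<zero>\<^bsub>F\<^esub>" and pE: "[int p] \<cdot>\<^bsub>E\<^esub> \<one>\<^bsub>E\<^esub> = \<zero>\<^bsub>E\<^esub>"
    and k: "k > 0" and x: "x \<in> carrier F" "x [^]\<^bsub>F\<^esub> k = \<one>\<^bsub>F\<^esub>"
    and Y: "Y \<subseteq> carrier E" "card Y = k" "\<And>y. y \<in> Y \<Longrightarrow> y [^]\<^bsub>E\<^esub> k = \<one>\<^bsub>E\<^esub>"
  obtains y where "y \<in> Y" "\<And>P. ipoly_eval F x P = \<zero>\<^bsub>F\<^esub> \<longleftrightarrow> ipoly_eval E y P = \<zero>\<^bsub>E\<^esub>"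
proof -
  interpret F: domain F by fact
  interpret E: domain E by fact
  define h :: "int poly" where "h = Polynomial.monom 1 k - 1"
  have h: "lead_coeff h = 1" "degree h = k"
    using lead_coeff_pow_minus_1[OF k] by (simp_all add: h_def)
  have hx: "ipoly_eval F x h = \<zero>\<^bsub>F\<^esub>"
    using x by (simp add: h_def F.ipoly_eval_diff F.ipoly_eval_monom)
  obtain f where f: "lead_coeff f = 1" "ipoly_eval F x f = \<zero>\<^bsub>F\<^esub>" "degree f \<le> degree h"
    and f_min: "\<And>g. lead_coeff g = 1 \<Longrightarrow> ipoly_eval F x g = \<zero>\<^bsub>F\<^esub> \<Longrightarrow> degree f \<le> degree g"
    using F.minimal_monic_annihilator[OF h(1) hx] by blast
  have not_one: "degree g > 0" if "lead_coeff g = 1" "g \<noteq> 1" for g :: "int poly"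
    using that by (metis degree_0_id neq0_conv one_pCons)
  \<comment> \<open>The constant 1 does not vanish in a domain. Positive degree of \<open>f\<close>
    makes the cofactor \<open>g\<close> have degree less than \<open>k\<close>.\<close>
  have "f \<noteq> 1" using f(2) x(1) by auto
  then have deg_f: "degree f > 0" using f(1) not_one by blast
  obtain g S where g: "h = f * g + smult (int p) S"
    "smult (int p) S = 0 \<or> degree (smult (int p) S) < degree f"
    using F.ipoly_eval_kernel[OF x(1) p pF f(1,2) f_min hx] by blast
  note g' = monic_cofactor[OF f(1) h(1) g f(3)]
  \<comment> \<open>\<open>g\<close> has fewer than \<open>k\<close> roots, so some \<open>y\<close>
    in \<open>Y\<close> is not among them. At that \<open>y\<close> the product \<open>f * g\<close>
    vanishes modulo \<open>p\<close>, hence \<open>f\<close> does.\<close>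
  have "card {y \<in> carrier E. ipoly_eval E y g = \<zero>\<^bsub>E\<^esub>} < card Y"
    using E.card_roots_ipoly_eval_le[OF finE g'(1)] g'(2) h(2) Y(2) deg_f by linarith
  moreover have "finite {y \<in> carrier E. ipoly_eval E y g = \<zero>\<^bsub>E\<^esub>}" using finE by simp
  ultimately have "\<not> Y \<subseteq> {y \<in> carrier E. ipoly_eval E y g = \<zero>\<^bsub>E\<^esub>}"
    by (meson card_mono leD)
  then obtain y where y: "y \<in> Y" "y \<in> carrier E" "ipoly_eval E y g \<noteq> \<zero>\<^bsub>E\<^esub>"
    using Y(1) by blast
  have "ipoly_eval E y h = \<zero>\<^bsub>E\<^esub>"
    using y Y(3) by (simp add: h_def E.ipoly_eval_diff E.ipoly_eval_monom)
  then have fy: "ipoly_eval E y f = \<zero>\<^bsub>E\<^esub>"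
    unfolding g using y pE
    by (auto simp: E.ipoly_eval_add E.ipoly_eval_mult E.ipoly_eval_smult E.integral_iff)
  \<comment> \<open>Now the roles are exchanged: \<open>f'\<close> is minimal at \<open>y\<close>
    and divides \<open>f\<close> modulo \<open>p\<close>. The cofactor \<open>Q\<close> is monic of
    smaller degree than \<open>f\<close>, so it does not vanish at \<open>x\<close>; therefore
    \<open>f'\<close> does.\<close>
  obtain f' where f': "lead_coeff f' = 1" "ipoly_eval E y f' = \<zero>\<^bsub>E\<^esub>" "degree f' \<le> degree f"
    and f'_min: "\<And>g. lead_coeff g = 1 \<Longrightarrow> ipoly_eval E y g = \<zero>\<^bsub>E\<^esub> \<Longrightarrow> degree f' \<le> degree g"
    using E.minimal_monic_annihilator[OF f(1) fy] by blast
  have "f' \<noteq> 1" using f'(2) y(2) by auto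
  then have deg_f': "degree f' > 0" using f'(1) not_one by blast
  obtain Q T where Q: "f = f' * Q + smult (int p) T"
    "smult (int p) T = 0 \<or> degree (smult (int p) T) < degree f'"
    using E.ipoly_eval_kernel[OF y(2) p pE f'(1,2) f'_min fy] by blast
  note Q' = monic_cofactor[OF f'(1) f(1) Q f'(3)]
  have "ipoly_eval F x Q \<noteq> \<zero>\<^bsub>F\<^esub>"
    using f_min[OF Q'(1)] Q'(2) deg_f' by linarith
  moreover have "ipoly_eval F x f' \<otimes>\<^bsub>F\<^esub> ipoly_eval F x Q = \<zero>\<^bsub>F\<^esub>"
    using f(2) x(1) pF unfolding Q
    by (simp add: F.ipoly_eval_add F.ipoly_eval_mult F.ipoly_eval_smult)
  ultimately have f'x: "ipoly_eval F x f' = \<zero>\<^bsub>F\<^esub>"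
    using x(1) by (simp add: F.integral_iff)
  have "ipoly_eval F x P = \<zero>\<^bsub>F\<^esub> \<longleftrightarrow> ipoly_eval E y P = \<zero>\<^bsub>E\<^esub>" for P
  proof
    assume "ipoly_eval F x P = \<zero>\<^bsub>F\<^esub>"
    then obtain U V where "P = f * U + smult (int p) V"
      using F.ipoly_eval_kernel[OF x(1) p pF f(1,2) f_min] by blast
    then show "ipoly_eval E y P = \<zero>\<^bsub>E\<^esub>"
      using y(2) fy pE by (simp add: E.ipoly_eval_add E.ipoly_eval_mult E.ipoly_eval_smult)
  next
    assume "ipoly_eval E y P = \<zero>\<^bsub>E\<^esub>"
    then obtain U V where "P = f' * U + smult (int p) V"
      using E.ipoly_eval_kernel[OF y(2) p pE f'(1,2) f'_min] by blast
    then show "ipoly_eval F x P = \<zero>\<^bsub>F\<^esub>"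
      using x(1) f'x pF by (simp add: F.ipoly_eval_add F.ipoly_eval_mult F.ipoly_eval_smult)
  qed
  with that y(1) show thesis by blast
qed

text \<open>The additive group has order \<open>p ^ r\<close>, so the \<open>r\<close>-th power of
  \<open>[int p] \<cdot> \<one>\<close> is zero, and a domain has no nonzero nilpotents.\<close>

lemma (in domain) prime_card_imp_char:
  assumes "finite (carrier R)" "card (carrier R) = p ^ r"
  shows "[int p] \<cdot> \<one> = \<zero>"
proof -
  have *: "[int (p ^ n)] \<cdot> \<one> = ([int p] \<cdot> \<one>) [^] n" for n
    by (induction n) (auto simp: int_mult_one m_comm)
  have "[int (p ^ r)] \<cdot> \<one> = \<zero>"
    using add.pow_order_eq_1[of \<one>] assms unfolding add_pow_def int_pow_int
    by (simp add: Coset.order_def)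
  then have "([int p] \<cdot> \<one>) [^] r = \<zero>" using * by simp
  moreover have "y = \<zero>" if "y \<in> carrier R" "y [^] n = \<zero>" for y and n :: nat
    using that(2) by (induction n) (use that(1) in \<open>auto simp: integral_iff\<close>)
  ultimately show ?thesis by blast
qed

section \<open>Translated cosets and pairs of points on them\<close>

context field
begin

lemma mem_translated_coset_iff:
  "s \<in> (H #> a) +> c \<longleftrightarrow> (\<exists>u\<in>H. s = u \<otimes> a \<oplus> c)"
  by (auto simp: r_coset_def a_r_coset_def)

lemma inv_mult_eq_iff:
  assumes "a \<in> carrier R" "b \<in> carrier R" "e \<in> carrier R" "e \<noteq> \<zero>"
  shows "a = inv e \<otimes> b \<longleftrightarrow> a \<otimes> e = b"
proof -
  have e: "e \<in> Units R" using assms field_Units by auto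
  then show ?thesis
    using assms by (metis Units_inv_closed Units_l_inv Units_r_inv m_assoc m_comm l_one)
qed

text \<open>Clears the denominator of a quotient such as \<open>c_elem\<close>, so that later
  arguments are free of inverses.\<close>

lemma mem_coset_quotient_iff:
  assumes "H \<subseteq> carrier R" "a \<in> carrier R" "b \<in> carrier R" "e \<in> carrier R" "e \<noteq> \<zero>"
  shows "a \<in> H #> (inv e \<otimes> b) \<longleftrightarrow> (\<exists>g\<in>H. a \<otimes> e = g \<otimes> b)"
proof -
  have e: "inv e \<in> carrier R" using assms field_Units by auto
  have "a = g \<otimes> (inv e \<otimes> b) \<longleftrightarrow> a \<otimes> e = g \<otimes> b" if "g \<in> H" for g
  proof -
    have "g \<in> carrier R" using that assms by auto
    then have "g \<otimes> (inv e \<otimes> b) = inv e \<otimes> (g \<otimes> b)"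
      using e assms by (simp add: m_lcomm)
    then show ?thesis using inv_mult_eq_iff[of a "g \<otimes> b" e] assms \<open>g \<in> carrier R\<close> by simp
  qed
  then show ?thesis by (auto simp: r_coset_def)
qed

text \<open>Subtracting the two incidences eliminates \<open>c\<close> and gives the first identity;
  multiplying \<open>t = v a + c\<close> by \<open>Y - 1\<close> and inserting the first gives the
  second.\<close>

lemma affine_pair_relation:
  assumes carr: "a \<in> carrier R" "c \<in> carrier R" "t \<in> carrier R" "v \<in> carrier R" "X \<in> carrier R" "Y \<in> carrier R"
    and t: "t = v \<otimes> a \<oplus> c" and s: "X \<otimes> t = (Y \<otimes> v) \<otimes> a \<oplus> c"
  shows "(v \<otimes> a) \<otimes> (Y \<ominus> \<one>) = t \<otimes> (X \<ominus> \<one>)"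
    and "c \<otimes> (Y \<ominus> \<one>) = t \<otimes> (Y \<ominus> X)"
proof -
  have "(v \<otimes> a) \<otimes> (Y \<ominus> \<one>) = ((Y \<otimes> v) \<otimes> a \<oplus> c) \<ominus> (v \<otimes> a \<oplus> c)"
    using carr by algebra
  also have "\<dots> = X \<otimes> t \<ominus> t" by (simp only: t[symmetric] s[symmetric])
  also have "\<dots> = t \<otimes> (X \<ominus> \<one>)" using carr by algebra
  finally show va: "(v \<otimes> a) \<otimes> (Y \<ominus> \<one>) = t \<otimes> (X \<ominus> \<one>)" .
  have "c \<otimes> (Y \<ominus> \<one>) = (v \<otimes> a \<oplus> c) \<otimes> (Y \<ominus> \<one>) \<ominus> (v \<otimes> a) \<otimes> (Y \<ominus> \<one>)"
    using carr by algebra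
  also have "\<dots> = t \<otimes> (Y \<ominus> \<one>) \<ominus> t \<otimes> (X \<ominus> \<one>)"
    by (simp only: va t[symmetric])
  also have "\<dots> = t \<otimes> (Y \<ominus> X)" using carr by algebra
  finally show "c \<otimes> (Y \<ominus> \<one>) = t \<otimes> (Y \<ominus> X)" .
qed

lemma affine_pair_of_relation:
  assumes carr: "a \<in> carrier R" "c \<in> carrier R" "t \<in> carrier R" "v \<in> carrier R" "X \<in> carrier R" "Y \<in> carrier R"
    and Y: "Y \<noteq> \<one>"
    and va: "(v \<otimes> a) \<otimes> (Y \<ominus> \<one>) = t \<otimes> (X \<ominus> \<one>)"
    and c: "c \<otimes> (Y \<ominus> \<one>) = t \<otimes> (Y \<ominus> X)"
  shows "t = v \<otimes> a \<oplus> c" "X \<otimes> t = (Y \<otimes> v) \<otimes> a \<oplus> c"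
proof -
  have Y': "Y \<ominus> \<one> \<noteq> \<zero>" using Y carr by simp
  have "(v \<otimes> a \<oplus> c) \<otimes> (Y \<ominus> \<one>) = (v \<otimes> a) \<otimes> (Y \<ominus> \<one>) \<oplus> c \<otimes> (Y \<ominus> \<one>)"
    using carr by algebra
  also have "\<dots> = t \<otimes> (X \<ominus> \<one>) \<oplus> t \<otimes> (Y \<ominus> X)" by (simp only: va c)
  also have "\<dots> = t \<otimes> (Y \<ominus> \<one>)" using carr by algebra
  finally show t: "t = v \<otimes> a \<oplus> c" using m_rcancel[OF Y'] carr by simp
  have "(Y \<otimes> v) \<otimes> a \<oplus> c = (v \<otimes> a) \<otimes> (Y \<ominus> \<one>) \<oplus> (v \<otimes> a \<oplus> c)" using carr by algebra
  also have "\<dots> = t \<otimes> (X \<ominus> \<one>) \<oplus> t" by (simp only: va t[symmetric])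
  also have "\<dots> = X \<otimes> t" using carr by algebra
  finally show "X \<otimes> t = (Y \<otimes> v) \<otimes> a \<oplus> c" ..
qed

lemma subgroup_mult_of_facts:
  assumes "subgroup H (mult_of R)"
  shows "H \<subseteq> carrier R" "\<zero> \<notin> H" "\<one> \<in> H"
    "\<And>x y. x \<in> H \<Longrightarrow> y \<in> H \<Longrightarrow> x \<otimes> y \<in> H"
    "\<And>x (n::nat). x \<in> H \<Longrightarrow> x [^] n \<in> H"
    "\<And>x y. x \<in> H \<Longrightarrow> y \<in> H \<Longrightarrow> \<exists>g\<in>H. x = g \<otimes> y"
proof -
  interpret H: subgroup H "mult_of R" by fact
  show 1: "H \<subseteq> carrier R" "\<zero> \<notin> H" "\<one> \<in> H"
    and 2: "\<And>x y. x \<in> H \<Longrightarrow> y \<in> H \<Longrightarrow> x \<otimes> y \<in> H"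
    using H.subset H.one_closed H.m_closed by auto
  show "x [^] n \<in> H" if "x \<in> H" for x and n :: nat
    by (induction n) (use 1 2 that in auto)
  show "\<exists>g\<in>H. x = g \<otimes> y" if "x \<in> H" "y \<in> H" for x y
  proof
    have y: "y \<in> Units R" and x: "x \<in> carrier R" using that 1 field_Units by auto
    have "inv\<^bsub>mult_of R\<^esub> y = inv y"
      using H.mem_carrier[OF that(2)] by (rule m_inv_mult_of)
    then have "inv y \<in> H" using H.m_inv_closed[OF that(2)] by simp
    then show "x \<otimes> inv y \<in> H" using that(1) 2 by blast
    show "x = x \<otimes> inv y \<otimes> y"
      using x y m_assoc[OF x Units_inv_closed[OF y] Units_closed[OF y]] by simp
  qed
qed

text \<open>\<open>X\<close> and \<open>Y\<close> are the ratios of a second point to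
  \<open>t\<close> and of its coset parameter to \<open>v\<close>. \<open>X = 1\<close> or
  \<open>Y = 1\<close> would give \<open>s = t\<close>; \<open>X = Y\<close> would give
  \<open>c (Y - 1) = 0\<close>.\<close>

lemma affine_pair_ratios:
  assumes H: "subgroup H (mult_of R)" and a: "a \<in> carrier R" and c: "c \<in> carrier R" "c \<noteq> \<zero>"
    and t: "t \<in> H" "v \<in> H" "t = v \<otimes> a \<oplus> c"
    and s: "s \<in> H" "s \<in> (H #> a) +> c" "s \<noteq> t"
  obtains X Y where "X \<in> H" "Y \<in> H" "s = X \<otimes> t" "X \<otimes> t = (Y \<otimes> v) \<otimes> a \<oplus> c"
    "X \<noteq> \<one>" "Y \<noteq> \<one>" "X \<noteq> Y"
proof -
  note H' = subgroup_mult_of_facts[OF H]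
  from s obtain u where u: "u \<in> H" "s = u \<otimes> a \<oplus> c" by (auto simp: mem_translated_coset_iff)
  obtain X where X: "X \<in> H" "s = X \<otimes> t" using H'(6) s t by blast
  obtain Y where Y: "Y \<in> H" "u = Y \<otimes> v" using H'(6) u t by blast
  have carr: "t \<in> carrier R" "v \<in> carrier R" "X \<in> carrier R" "Y \<in> carrier R"
    using H' X Y t by auto
  have st: "X \<otimes> t = (Y \<otimes> v) \<otimes> a \<oplus> c" using X Y u by simp
  have "X \<noteq> \<one>" using X s carr by auto
  moreover have Y1: "Y \<noteq> \<one>" using Y u s t carr by auto
  moreover have "X \<noteq> Y"
  proof
    assume "X = Y"
    then have "c \<otimes> (Y \<ominus> \<one>) = \<zero>"
      using affine_pair_relation(2)[OF a c(1) carr t(3) st] carr by (simp add: minus_eq r_neg)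
    then show False using c Y1 carr by (simp add: integral_iff)
  qed
  ultimately show thesis using that X Y st by blast
qed

end

section \<open>Transfer of the two-point bound from \<open>E\<close> to \<open>F\<close>\<close>

lemma three_elements:
  assumes "\<not> card A \<le> 2"
  obtains x y z where "x \<in> A" "y \<in> A" "z \<in> A" "x \<noteq> y" "x \<noteq> z" "y \<noteq> z"
proof -
  from assms have "3 \<le> card A" by simp
  then obtain B where "B \<subseteq> A" "card B = 3" by (rule obtain_subset_with_card_n)
  then show thesis using that by (auto simp: card_3_iff)
qed

lemma circular_bound_transfer:
  assumes "field F" "field E" and fin: "finite (carrier E)"
    and \<Psi>: "subgroup \<Psi> (mult_of E)" "circular E \<Psi>" "y \<in> \<Psi>"
    and \<Phi>: "subgroup \<Phi> (mult_of F)" "\<Phi> = range (\<lambda>n::nat. x [^]\<^bsub>F\<^esub> n)" and x: "x \<in> carrier F"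
    and ker: "\<And>P. ipoly_eval F x P = \<zero>\<^bsub>F\<^esub> \<longleftrightarrow> ipoly_eval E y P = \<zero>\<^bsub>E\<^esub>"
    and a: "a \<in> carrier F" and c: "c \<in> carrier F" "c \<noteq> \<zero>\<^bsub>F\<^esub>"
  shows "inter_number F \<Phi> a c \<le> 2"
proof (rule ccontr)
  interpret F: field F by fact
  interpret E: field E by fact
  note \<Phi>' = F.subgroup_mult_of_facts[OF \<Phi>(1)]
  note \<Psi>' = E.subgroup_mult_of_facts[OF \<Psi>(1)]
  have y: "y \<in> carrier E" using \<Psi> \<Psi>' by auto
  \<comment> \<open>Equalities between powers are vanishing statements for integer polynomials, and
    \<open>ker\<close> is an equivalence, so distinctness passes to \<open>y\<close> as
    well.\<close>
  have pow_eq: "x [^]\<^bsub>F\<^esub> m = x [^]\<^bsub>F\<^esub> n \<longleftrightarrow> y [^]\<^bsub>E\<^esub> m = y [^]\<^bsub>E\<^esub> n" for m n :: nat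
    using ker[of "Polynomial.monom 1 m - Polynomial.monom 1 n"] x y
    by (simp add: F.ipoly_eval_diff E.ipoly_eval_diff F.ipoly_eval_monom E.ipoly_eval_monom)
  have pow_eq_1: "x [^]\<^bsub>F\<^esub> m = \<one>\<^bsub>F\<^esub> \<longleftrightarrow> y [^]\<^bsub>E\<^esub> m = \<one>\<^bsub>E\<^esub>" for m :: nat
    using pow_eq[of m 0] by simp
  assume "\<not> inter_number F \<Phi> a c \<le> 2"
  then obtain t s s' where t: "t \<in> \<Phi>" "t \<in> (\<Phi> #>\<^bsub>F\<^esub> a) +>\<^bsub>F\<^esub> c"
    and s: "s \<in> \<Phi>" "s \<in> (\<Phi> #>\<^bsub>F\<^esub> a) +>\<^bsub>F\<^esub> c" "s \<noteq> t"
    and s': "s' \<in> \<Phi>" "s' \<in> (\<Phi> #>\<^bsub>F\<^esub> a) +>\<^bsub>F\<^esub> c" "s' \<noteq> t" "s' \<noteq> s"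
    unfolding inter_number_def by (elim three_elements) auto
  from t obtain v where v: "v \<in> \<Phi>" "t = v \<otimes>\<^bsub>F\<^esub> a \<oplus>\<^bsub>F\<^esub> c" by (auto simp: F.mem_translated_coset_iff)
  obtain X Y where X: "X \<in> \<Phi>" "Y \<in> \<Phi>" "s = X \<otimes>\<^bsub>F\<^esub> t" "X \<otimes>\<^bsub>F\<^esub> t = (Y \<otimes>\<^bsub>F\<^esub> v) \<otimes>\<^bsub>F\<^esub> a \<oplus>\<^bsub>F\<^esub> c"
    "X \<noteq> \<one>\<^bsub>F\<^esub>" "Y \<noteq> \<one>\<^bsub>F\<^esub>" "X \<noteq> Y"
    using F.affine_pair_ratios[OF \<Phi>(1) a c t(1) v s] by blast
  obtain X' Y' where X': "X' \<in> \<Phi>" "Y' \<in> \<Phi>" "s' = X' \<otimes>\<^bsub>F\<^esub> t" "X' \<otimes>\<^bsub>F\<^esub> t = (Y' \<otimes>\<^bsub>F\<^esub> v) \<otimes>\<^bsub>F\<^esub> a \<oplus>\<^bsub>F\<^esub> c"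
    "X' \<noteq> \<one>\<^bsub>F\<^esub>" "Y' \<noteq> \<one>\<^bsub>F\<^esub>" "X' \<noteq> Y'"
    using F.affine_pair_ratios[OF \<Phi>(1) a c t(1) v s'(1-3)] by blast
  have carr: "t \<in> carrier F" "v \<in> carrier F" "X \<in> carrier F" "Y \<in> carrier F" "X' \<in> carrier F" "Y' \<in> carrier F"
    using \<Phi>' X X' t v by auto
  have "t \<noteq> \<zero>\<^bsub>F\<^esub>" using t \<Phi>' by auto
  note r = F.affine_pair_relation(1)[OF a c(1) carr(1-4) v(2) X(4)]
  note r' = F.affine_pair_relation(1)[OF a c(1) carr(1,2,5,6) v(2) X'(4)]
  \<comment> \<open>Both sides equal \<open>v a (Y - 1) (Y' - 1)\<close>; cancelling
    \<open>t\<close> leaves a relation in powers of \<open>x\<close> alone, without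
    \<open>a\<close>, \<open>c\<close> and \<open>v\<close>.\<close>
  have "t \<otimes>\<^bsub>F\<^esub> ((X \<ominus>\<^bsub>F\<^esub> \<one>\<^bsub>F\<^esub>) \<otimes>\<^bsub>F\<^esub> (Y' \<ominus>\<^bsub>F\<^esub> \<one>\<^bsub>F\<^esub>)) = (t \<otimes>\<^bsub>F\<^esub> (X \<ominus>\<^bsub>F\<^esub> \<one>\<^bsub>F\<^esub>)) \<otimes>\<^bsub>F\<^esub> (Y' \<ominus>\<^bsub>F\<^esub> \<one>\<^bsub>F\<^esub>)"
    using carr by (simp add: F.m_assoc)
  also have "\<dots> = ((v \<otimes>\<^bsub>F\<^esub> a) \<otimes>\<^bsub>F\<^esub> (Y' \<ominus>\<^bsub>F\<^esub> \<one>\<^bsub>F\<^esub>)) \<otimes>\<^bsub>F\<^esub> (Y \<ominus>\<^bsub>F\<^esub> \<one>\<^bsub>F\<^esub>)"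
    unfolding r[symmetric] using carr a by (simp add: F.m_ac)
  also have "\<dots> = t \<otimes>\<^bsub>F\<^esub> ((X' \<ominus>\<^bsub>F\<^esub> \<one>\<^bsub>F\<^esub>) \<otimes>\<^bsub>F\<^esub> (Y \<ominus>\<^bsub>F\<^esub> \<one>\<^bsub>F\<^esub>))"
    unfolding r' using carr by (simp add: F.m_assoc)
  finally have cross: "(X \<ominus>\<^bsub>F\<^esub> \<one>\<^bsub>F\<^esub>) \<otimes>\<^bsub>F\<^esub> (Y' \<ominus>\<^bsub>F\<^esub> \<one>\<^bsub>F\<^esub>) = (X' \<ominus>\<^bsub>F\<^esub> \<one>\<^bsub>F\<^esub>) \<otimes>\<^bsub>F\<^esub> (Y \<ominus>\<^bsub>F\<^esub> \<one>\<^bsub>F\<^esub>)"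
    using carr \<open>t \<noteq> _\<close> by (simp add: F.m_lcancel)
  obtain i j i' j' :: nat where ij: "X = x [^]\<^bsub>F\<^esub> i" "Y = x [^]\<^bsub>F\<^esub> j" "X' = x [^]\<^bsub>F\<^esub> i'" "Y' = x [^]\<^bsub>F\<^esub> j'"
    using X(1,2) X'(1,2) \<Phi>(2) by auto
  define U V U' V' where UV: "U = y [^]\<^bsub>E\<^esub> i" "V = y [^]\<^bsub>E\<^esub> j" "U' = y [^]\<^bsub>E\<^esub> i'" "V' = y [^]\<^bsub>E\<^esub> j'"
  have carrE: "U \<in> carrier E" "V \<in> carrier E" "U' \<in> carrier E" "V' \<in> carrier E"
    using y by (simp_all add: UV)
  have in\<Psi>: "U \<in> \<Psi>" "V \<in> \<Psi>" "U' \<in> \<Psi>" "V' \<in> \<Psi>"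
    using \<Psi> \<Psi>' by (simp_all add: UV)
  have "X \<noteq> X'" using X(3) X'(3) s'(4) by auto
  then have neq: "U \<noteq> \<one>\<^bsub>E\<^esub>" "U' \<noteq> \<one>\<^bsub>E\<^esub>" "V \<noteq> \<one>\<^bsub>E\<^esub>" "U \<noteq> V" "U \<noteq> U'"
    using X(5-7) X'(5) \<open>X \<noteq> X'\<close> pow_eq pow_eq_1 unfolding UV ij by simp_all
  have crossE: "(U \<ominus>\<^bsub>E\<^esub> \<one>\<^bsub>E\<^esub>) \<otimes>\<^bsub>E\<^esub> (V' \<ominus>\<^bsub>E\<^esub> \<one>\<^bsub>E\<^esub>) = (U' \<ominus>\<^bsub>E\<^esub> \<one>\<^bsub>E\<^esub>) \<otimes>\<^bsub>E\<^esub> (V \<ominus>\<^bsub>E\<^esub> \<one>\<^bsub>E\<^esub>)"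
    using ker[of "(Polynomial.monom 1 i - 1) * (Polynomial.monom 1 j' - 1)
        - (Polynomial.monom 1 i' - 1) * (Polynomial.monom 1 j - 1)"] cross x y carr carrE
    unfolding UV ij
    by (simp add: F.ipoly_eval_diff E.ipoly_eval_diff F.ipoly_eval_monom E.ipoly_eval_monom
        F.ipoly_eval_mult E.ipoly_eval_mult)
  \<comment> \<open>Scaling by \<open>b\<close> sends \<open>V - 1\<close> to \<open>U - 1\<close>,
    and by the cross relation it then sends \<open>V' - 1\<close> to \<open>U' - 1\<close>.\<close>
  define b where "b = inv\<^bsub>E\<^esub> (V \<ominus>\<^bsub>E\<^esub> \<one>\<^bsub>E\<^esub>) \<otimes>\<^bsub>E\<^esub> (U \<ominus>\<^bsub>E\<^esub> \<one>\<^bsub>E\<^esub>)"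
  have V1: "V \<ominus>\<^bsub>E\<^esub> \<one>\<^bsub>E\<^esub> \<noteq> \<zero>\<^bsub>E\<^esub>" using neq carrE by simp
  then have b: "b \<in> carrier E" unfolding b_def using carrE E.field_Units by auto
  have bV: "b \<otimes>\<^bsub>E\<^esub> (V \<ominus>\<^bsub>E\<^esub> \<one>\<^bsub>E\<^esub>) = U \<ominus>\<^bsub>E\<^esub> \<one>\<^bsub>E\<^esub>"
    using E.inv_mult_eq_iff[OF b _ _ V1, of "U \<ominus>\<^bsub>E\<^esub> \<one>\<^bsub>E\<^esub>"] carrE by (simp add: b_def)
  have "(b \<otimes>\<^bsub>E\<^esub> (V' \<ominus>\<^bsub>E\<^esub> \<one>\<^bsub>E\<^esub>)) \<otimes>\<^bsub>E\<^esub> (V \<ominus>\<^bsub>E\<^esub> \<one>\<^bsub>E\<^esub>) = (b \<otimes>\<^bsub>E\<^esub> (V \<ominus>\<^bsub>E\<^esub> \<one>\<^bsub>E\<^esub>)) \<otimes>\<^bsub>E\<^esub> (V' \<ominus>\<^bsub>E\<^esub> \<one>\<^bsub>E\<^esub>)"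
    using b carrE by (simp add: E.m_ac)
  also have "\<dots> = (U' \<ominus>\<^bsub>E\<^esub> \<one>\<^bsub>E\<^esub>) \<otimes>\<^bsub>E\<^esub> (V \<ominus>\<^bsub>E\<^esub> \<one>\<^bsub>E\<^esub>)" unfolding bV crossE ..
  finally have bV': "b \<otimes>\<^bsub>E\<^esub> (V' \<ominus>\<^bsub>E\<^esub> \<one>\<^bsub>E\<^esub>) = U' \<ominus>\<^bsub>E\<^esub> \<one>\<^bsub>E\<^esub>"
    using b carrE E.m_rcancel[OF V1] by simp
  have b0: "b \<noteq> \<zero>\<^bsub>E\<^esub>"
  proof
    assume "b = \<zero>\<^bsub>E\<^esub>"
    then have "U \<ominus>\<^bsub>E\<^esub> \<one>\<^bsub>E\<^esub> = \<zero>\<^bsub>E\<^esub>" using bV carrE by simp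
    then show False using neq carrE by simp
  qed
  \<comment> \<open>A zero translation would mean \<open>b = 1\<close> and hence
    \<open>U = V\<close>.\<close>
  have b1: "\<one>\<^bsub>E\<^esub> \<ominus>\<^bsub>E\<^esub> b \<noteq> \<zero>\<^bsub>E\<^esub>"
  proof
    assume "\<one>\<^bsub>E\<^esub> \<ominus>\<^bsub>E\<^esub> b = \<zero>\<^bsub>E\<^esub>"
    then have "b = \<one>\<^bsub>E\<^esub>" using b by simp
    then have "V \<ominus>\<^bsub>E\<^esub> \<one>\<^bsub>E\<^esub> = U \<ominus>\<^bsub>E\<^esub> \<one>\<^bsub>E\<^esub>" using bV carrE by simp
    then show False using neq carrE by (simp add: a_minus_def)
  qed
  have point: "W = W' \<otimes>\<^bsub>E\<^esub> b \<oplus>\<^bsub>E\<^esub> (\<one>\<^bsub>E\<^esub> \<ominus>\<^bsub>E\<^esub> b)"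
    if "b \<otimes>\<^bsub>E\<^esub> (W' \<ominus>\<^bsub>E\<^esub> \<one>\<^bsub>E\<^esub>) = W \<ominus>\<^bsub>E\<^esub> \<one>\<^bsub>E\<^esub>" "W \<in> carrier E" "W' \<in> carrier E" for W W'
  proof -
    have "W' \<otimes>\<^bsub>E\<^esub> b \<oplus>\<^bsub>E\<^esub> (\<one>\<^bsub>E\<^esub> \<ominus>\<^bsub>E\<^esub> b) = b \<otimes>\<^bsub>E\<^esub> (W' \<ominus>\<^bsub>E\<^esub> \<one>\<^bsub>E\<^esub>) \<oplus>\<^bsub>E\<^esub> \<one>\<^bsub>E\<^esub>"
      using that(2,3) b by algebra
    also have "\<dots> = W" unfolding that(1) using that(2) by algebra
    finally show ?thesis ..
  qed
  let ?I = "(\<Psi> #>\<^bsub>E\<^esub> \<one>\<^bsub>E\<^esub>) \<inter> ((\<Psi> #>\<^bsub>E\<^esub> b) +>\<^bsub>E\<^esub> (\<one>\<^bsub>E\<^esub> \<ominus>\<^bsub>E\<^esub> b))"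
  have \<Psi>1: "\<Psi> #>\<^bsub>E\<^esub> \<one>\<^bsub>E\<^esub> = \<Psi>" using \<Psi>'(1) by (force simp: r_coset_def)
  \<comment> \<open>The instance of the premise of \<open>point\<close> for the third point, one
    itself.\<close>
  have "b \<otimes>\<^bsub>E\<^esub> (\<one>\<^bsub>E\<^esub> \<ominus>\<^bsub>E\<^esub> \<one>\<^bsub>E\<^esub>) = \<one>\<^bsub>E\<^esub> \<ominus>\<^bsub>E\<^esub> \<one>\<^bsub>E\<^esub>"
    using b by (simp add: a_minus_def E.r_neg)
  then have "{\<one>\<^bsub>E\<^esub>, U, U'} \<subseteq> ?I"
    unfolding \<Psi>1 using in\<Psi> \<Psi>'(3) point bV bV' carrE
    by (auto simp: E.mem_translated_coset_iff simp del: E.r_right_minus_eq)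
  moreover have "finite ?I" unfolding \<Psi>1 using \<Psi>'(1) fin finite_subset by blast
  moreover have "card {\<one>\<^bsub>E\<^esub>, U, U'} = 3" using neq by auto
  ultimately have "3 \<le> card ?I" using card_mono by metis
  \<comment> \<open>Circularity is applied with scalars one and \<open>b\<close> and translation
    \<open>1 - b\<close>, all nonzero.\<close>
  moreover have "card ?I \<le> 2"
    using \<Psi>(2) b b0 b1 unfolding circular_def by auto
  ultimately show False by simp
qed

section \<open>The two-point criterion, first by ratios and then by \<open>c_elem\<close>\<close>

context field
begin

lemma inter_number_eq_2_iff_ratios:
  assumes H: "subgroup H (mult_of R)" and fin: "finite H" and card: "card H \<noteq> 2"
    and a: "a \<in> carrier R" "a \<noteq> \<zero>" and c: "c \<in> carrier R"
    and bound: "c \<noteq> \<zero> \<Longrightarrow> inter_number R H a c \<le> 2"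
  shows "inter_number R H a c = 2 \<longleftrightarrow>
    (\<exists>X\<in>H. \<exists>Y\<in>H. X \<noteq> \<one> \<and> Y \<noteq> \<one> \<and> X \<noteq> Y \<and>
      (\<exists>u\<in>H. a \<otimes> (Y \<ominus> \<one>) = u \<otimes> (X \<ominus> \<one>)) \<and> (\<exists>t\<in>H. c \<otimes> (Y \<ominus> \<one>) = t \<otimes> (Y \<ominus> X)))"
    (is "?L \<longleftrightarrow> ?R")
proof
  note H' = subgroup_mult_of_facts[OF H]
  assume L: ?L
  then obtain s t where "H \<inter> ((H #> a) +> c) = {s, t}" and st: "s \<noteq> t"
    unfolding inter_number_def card_2_iff by auto
  then have s: "s \<in> H" "s \<in> (H #> a) +> c" and t: "t \<in> H" "t \<in> (H #> a) +> c" by auto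
  from t obtain v where v: "v \<in> H" "t = v \<otimes> a \<oplus> c" by (auto simp: mem_translated_coset_iff)
  have tv: "t \<in> carrier R" "v \<in> carrier R" using t v H' by auto
  \<comment> \<open>For \<open>c = 0\<close> a single common point makes the coset
    \<open>H a\<close> equal to \<open>H\<close>; the intersection then has \<open>card H\<close>
    elements, which is not 2.\<close>
  have c0: "c \<noteq> \<zero>"
  proof
    assume c0: "c = \<zero>"
    have "g \<in> (H #> a) +> c" if g: "g \<in> H" for g
    proof -
      obtain h where h: "h \<in> H" "g = h \<otimes> t" using H'(6) g t by blast
      have "g = (h \<otimes> v) \<otimes> a \<oplus> c"
        using h v tv H'(1) a c0 by (auto simp: m_assoc)
      then show ?thesis using H'(4) h v by (auto simp: mem_translated_coset_iff)
    qed
    then have "H \<inter> ((H #> a) +> c) = H" by auto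
    then show False using L card by (simp add: inter_number_def)
  qed
  obtain X Y where XY: "X \<in> H" "Y \<in> H" "s = X \<otimes> t" "X \<otimes> t = (Y \<otimes> v) \<otimes> a \<oplus> c"
    "X \<noteq> \<one>" "Y \<noteq> \<one>" "X \<noteq> Y"
    using affine_pair_ratios[OF H a(1) c c0 t(1) v s st] by blast
  have carr: "X \<in> carrier R" "Y \<in> carrier R" using XY H' by auto
  note rel = affine_pair_relation[OF a(1) c tv carr v(2) XY(4)]
  \<comment> \<open>Dividing the first relation by \<open>v\<close> replaces \<open>t\<close> by
    \<open>u = t / v\<close>, again in \<open>H\<close>.\<close>
  obtain u where u: "u \<in> H" "t = u \<otimes> v" using H'(6) t v by blast
  have u': "u \<in> carrier R" and v0: "v \<noteq> \<zero>" using u v H' by auto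
  have "v \<otimes> (a \<otimes> (Y \<ominus> \<one>)) = (v \<otimes> a) \<otimes> (Y \<ominus> \<one>)"
    using tv a carr by (simp add: m_assoc)
  also have "\<dots> = v \<otimes> (u \<otimes> (X \<ominus> \<one>))"
    unfolding rel u(2) using u' tv carr by (simp add: m_ac)
  finally have "a \<otimes> (Y \<ominus> \<one>) = u \<otimes> (X \<ominus> \<one>)"
    using m_lcancel[OF v0 tv(2)] a carr u' by simp
  with u t XY rel(2) show ?R by blast
next
  note H' = subgroup_mult_of_facts[OF H]
  assume ?R
  then obtain X Y u t where XY: "X \<in> H" "Y \<in> H" "X \<noteq> \<one>" "Y \<noteq> \<one>" "X \<noteq> Y"
    and u: "u \<in> H" "a \<otimes> (Y \<ominus> \<one>) = u \<otimes> (X \<ominus> \<one>)"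
    and t: "t \<in> H" "c \<otimes> (Y \<ominus> \<one>) = t \<otimes> (Y \<ominus> X)" by blast
  \<comment> \<open>With \<open>v = t / u\<close> the two given equations become exactly the
    relations of a pair of points \<open>t\<close> and \<open>X t\<close>.\<close>
  obtain v where v: "v \<in> H" "t = v \<otimes> u" using H'(6) t u by blast
  have carr: "X \<in> carrier R" "Y \<in> carrier R" "u \<in> carrier R" "t \<in> carrier R" "v \<in> carrier R"
    using XY u t v H' by auto
  have t0: "t \<noteq> \<zero>" using t H' by auto
  have "(v \<otimes> a) \<otimes> (Y \<ominus> \<one>) = v \<otimes> (a \<otimes> (Y \<ominus> \<one>))" using carr a by (simp add: m_assoc)
  also have "\<dots> = t \<otimes> (X \<ominus> \<one>)" unfolding u(2) v(2) using carr by (simp add: m_assoc)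
  finally have va: "(v \<otimes> a) \<otimes> (Y \<ominus> \<one>) = t \<otimes> (X \<ominus> \<one>)" .
  note pts = affine_pair_of_relation[OF a(1) c carr(4,5,1,2) XY(4) va t(2)]
  \<comment> \<open>\<open>X \<noteq> Y\<close> forces \<open>c\<close> to be nonzero, which makes
    \<open>bound\<close> available.\<close>
  have "c \<noteq> \<zero>"
  proof
    assume "c = \<zero>"
    then have "t \<otimes> (Y \<ominus> X) = \<zero>" using t(2) carr by simp
    then show False using t0 XY carr by (simp add: integral_iff)
  qed
  then have le: "inter_number R H a c \<le> 2" by (rule bound)
  have "t \<in> (H #> a) +> c"
    unfolding mem_translated_coset_iff using pts(1) v by blast
  moreover have "X \<otimes> t \<in> (H #> a) +> c"
    unfolding mem_translated_coset_iff using pts(2) v(1) XY(2) H'(4) by blast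
  ultimately have sub: "{t, X \<otimes> t} \<subseteq> H \<inter> ((H #> a) +> c)" using XY t H'(4) by auto
  have "X \<otimes> t \<noteq> \<one> \<otimes> t" using m_rcancel[OF t0 carr(4,1)] XY by blast
  then have "card {t, X \<otimes> t} = 2" using carr by auto
  then have "2 \<le> inter_number R H a c"
    unfolding inter_number_def using card_mono[OF _ sub] fin by simp
  with le show ?L by simp
qed

text \<open>For \<open>c\<close> the numerator is
  \<open>\<phi>^(j-i) - 1 = (\<phi>^j - \<phi>^i) / \<phi>^i\<close>, and the factor
  \<open>\<phi>^i\<close> lies in \<open>H\<close>, so the coset absorbs it.\<close>

lemma c_elem_coset_iff:
  assumes k: "\<phi> [^] k = \<one>" and primitive: "\<And>n::nat. 0 < n \<Longrightarrow> n < k \<Longrightarrow> \<phi> [^] n \<noteq> \<one>"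
    and H: "subgroup H (mult_of R)" "\<phi> \<in> H" and a: "a \<in> carrier R" and c: "c \<in> carrier R"
    and ij: "i \<in> {1..int k - 1}" "j \<in> {1..int k - 1}"
  shows "a \<in> H #> c_elem R k \<phi> j i \<longleftrightarrow>
      (\<exists>u\<in>H. a \<otimes> (\<phi> [^] nat j \<ominus> \<one>) = u \<otimes> (\<phi> [^] nat i \<ominus> \<one>))"
    and "c \<in> H #> c_elem R k \<phi> j (j - i) \<longleftrightarrow>
      (\<exists>t\<in>H. c \<otimes> (\<phi> [^] nat j \<ominus> \<one>) = t \<otimes> (\<phi> [^] nat j \<ominus> \<phi> [^] nat i))"
proof -
  note H' = subgroup_mult_of_facts[OF H(1)]
  have \<phi>: "\<phi> \<in> carrier R" using H H' by auto
  define Y where "Y = \<phi> [^] nat j"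
  define X where "X = \<phi> [^] nat i"
  define Z where "Z = \<phi> [^] nat ((j - i) mod int k)"
  have carr: "X \<in> carrier R" "Y \<in> carrier R" "Z \<in> carrier R" using \<phi> by (auto simp: X_def Y_def Z_def)
  have "Y \<noteq> \<one>" unfolding Y_def using ij by (intro primitive) auto
  then have Y1: "Y \<ominus> \<one> \<noteq> \<zero>" using carr by simp
  show "a \<in> H #> c_elem R k \<phi> j i \<longleftrightarrow>
      (\<exists>u\<in>H. a \<otimes> (\<phi> [^] nat j \<ominus> \<one>) = u \<otimes> (\<phi> [^] nat i \<ominus> \<one>))"
    using mem_coset_quotient_iff[OF H'(1) a _ _ Y1, of "X \<ominus> \<one>"] carr ij
    by (simp add: c_elem_def X_def Y_def)
  \<comment> \<open>For \<open>j < i\<close> the reduced index is \<open>j - i + k\<close>, so the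
    exponents agree only modulo \<open>k\<close>; \<open>\<phi>^k = 1\<close> repairs this and gives
    \<open>Z X = Y\<close>.\<close>
  have "(nat ((j - i) mod int k) + nat i) mod k = nat j mod k"
  proof -
    have "int ((nat ((j - i) mod int k) + nat i) mod k) = ((j - i) mod int k + i) mod int k"
      using ij by (simp add: zmod_int)
    also have "\<dots> = int (nat j mod k)" using ij by (simp add: mod_add_left_eq zmod_int)
    finally show ?thesis by linarith
  qed
  moreover have pow_mod: "\<phi> [^] n = \<phi> [^] (n mod k)" for n
  proof -
    have "\<phi> [^] n = \<phi> [^] (k * (n div k) + n mod k)" by simp
    also have "\<dots> = (\<phi> [^] k) [^] (n div k) \<otimes> \<phi> [^] (n mod k)"
      using \<phi> by (simp only: nat_pow_mult nat_pow_pow)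
    finally show ?thesis using k \<phi> by simp
  qed
  ultimately have ZX: "Z \<otimes> X = Y"
    unfolding X_def Y_def Z_def using \<phi> by (metis nat_pow_mult)
  have ZX1: "X \<otimes> (Z \<ominus> \<one>) = Y \<ominus> X"
    unfolding ZX[symmetric] using carr by algebra
  have XH: "X \<in> H" using H H' by (simp add: X_def)
  have "c \<in> H #> c_elem R k \<phi> j (j - i) \<longleftrightarrow> (\<exists>w\<in>H. c \<otimes> (Y \<ominus> \<one>) = w \<otimes> (Z \<ominus> \<one>))"
    using mem_coset_quotient_iff[OF H'(1) c _ _ Y1, of "Z \<ominus> \<one>"] carr ij
    by (simp add: c_elem_def Z_def Y_def)
  also have "\<dots> \<longleftrightarrow> (\<exists>t\<in>H. c \<otimes> (Y \<ominus> \<one>) = t \<otimes> (Y \<ominus> X))"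
  proof
    assume "\<exists>w\<in>H. c \<otimes> (Y \<ominus> \<one>) = w \<otimes> (Z \<ominus> \<one>)"
    then obtain w where w: "w \<in> H" "c \<otimes> (Y \<ominus> \<one>) = w \<otimes> (Z \<ominus> \<one>)" by blast
    obtain t where t: "t \<in> H" "w = t \<otimes> X" using H'(6) w XH by blast
    have "t \<in> carrier R" using t H' by auto
    then have "w \<otimes> (Z \<ominus> \<one>) = t \<otimes> (Y \<ominus> X)"
      unfolding t(2) ZX1[symmetric] using carr by (simp add: m_assoc)
    with w t show "\<exists>t\<in>H. c \<otimes> (Y \<ominus> \<one>) = t \<otimes> (Y \<ominus> X)" by auto
  next
    assume "\<exists>t\<in>H. c \<otimes> (Y \<ominus> \<one>) = t \<otimes> (Y \<ominus> X)"
    then obtain t where t: "t \<in> H" "c \<otimes> (Y \<ominus> \<one>) = t \<otimes> (Y \<ominus> X)" by blast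
    have "t \<in> carrier R" using t H' by auto
    then have "t \<otimes> (Y \<ominus> X) = (t \<otimes> X) \<otimes> (Z \<ominus> \<one>)"
      unfolding ZX1[symmetric] using carr by (simp add: m_assoc)
    with t XH H'(4) show "\<exists>w\<in>H. c \<otimes> (Y \<ominus> \<one>) = w \<otimes> (Z \<ominus> \<one>)" by auto
  qed
  finally show "c \<in> H #> c_elem R k \<phi> j (j - i) \<longleftrightarrow>
      (\<exists>t\<in>H. c \<otimes> (\<phi> [^] nat j \<ominus> \<one>) = t \<otimes> (\<phi> [^] nat j \<ominus> \<phi> [^] nat i))"
    unfolding X_def Y_def .
qed

end

section \<open>Specialisation to the cyclic group generated by \<open>\<phi>\<close>\<close>

theorem theorem14:
  fixes F :: "('a, 'b) ring_scheme"
    and p r q k m :: nat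
    and \<zeta> \<phi> a c :: 'a
    and \<Phi> :: "'a set"
  assumes "Factorial_Ring.prime p"
    and "q = p ^ r"
    and "k \<ge> 3"
    and "k dvd (q - 1)"
    and "m = (q - 1) div k"
    and "field F"
    and "card (carrier F) = q"
    and "\<zeta> \<in> carrier (Multiplicative_Group.mult_of F)"
    and "generate (Multiplicative_Group.mult_of F) {\<zeta>} = carrier (Multiplicative_Group.mult_of F)"
    and "\<phi> = \<zeta> [^]\<^bsub>F\<^esub> m"
    and "\<Phi> = generate (Multiplicative_Group.mult_of F) {\<phi>}"
    and "circular_pair p k"
    and "a \<in> carrier F"
    and "c \<in> carrier F"
    and "a \<noteq> \<zero>\<^bsub>F\<^esub>"
  shows "inter_number F \<Phi> a c = 2 \<longleftrightarrow>
    (\<exists>i \<in> {1..int k - 1}. \<exists>j \<in> {1..int k - 1}. i \<noteq> j \<and>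
       a \<in> \<Phi> #>\<^bsub>F\<^esub> c_elem F k \<phi> j i \<and>
       c \<in> \<Phi> #>\<^bsub>F\<^esub> c_elem F k \<phi> j (j - i))"
proof -
  interpret F: field F by fact
  interpret G: group "mult_of F" by (rule F.field_mult_group)
  have q: "q > 0" using assms(1,2) by (simp add: prime_gt_0_nat)
  have finF: "finite (carrier F)" using q assms(7) card_gt_0_iff by metis
  have card_mult: "card (carrier (mult_of F)) = q - 1"
    using finF assms(7) by simp
  then have ord_\<zeta>: "G.ord \<zeta> = q - 1"
    using G.generate_pow_card[OF assms(8)] assms(9) by simp
  \<comment> \<open>The unit group contains one, so \<open>q - 1\<close> is positive; hence
    \<open>m\<close> is nonzero and dividing \<open>q - 1\<close> by \<open>m\<close> recovers
    \<open>k\<close>, the order of \<open>\<phi>\<close>.\<close>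
  have "card (carrier (mult_of F)) > 0"
    using finF G.one_closed by (subst card_gt_0_iff) auto
  then have q1: "q - 1 > 0" using card_mult by simp
  have mk: "q - 1 = m * k" using assms(4,5) by simp
  then have m: "m \<noteq> 0" "m dvd q - 1" using q1 by (auto intro!: notI)
  then have "(q - 1) div m = k" using mk by simp
  have \<phi>_eq: "\<phi> = \<zeta> [^]\<^bsub>mult_of F\<^esub> m" using assms(10) by (simp add: nat_pow_mult_of)
  have \<phi>G: "\<phi> \<in> carrier (mult_of F)" unfolding \<phi>_eq using assms(8) by (rule G.nat_pow_closed)
  then have \<phi>: "\<phi> \<in> carrier F" by simp
  have ord_\<phi>: "G.ord \<phi> = k"
    using G.ord_pow[OF assms(8), of m] m \<open>(q - 1) div m = k\<close> ord_\<zeta> by (simp add: \<phi>_eq)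
  have pow1: "\<phi> [^]\<^bsub>F\<^esub> n = \<one>\<^bsub>F\<^esub> \<longleftrightarrow> k dvd n" for n :: nat
    using G.pow_eq_id[OF \<phi>G, of n] ord_\<phi> by (simp add: nat_pow_mult_of)
  have k: "\<phi> [^]\<^bsub>F\<^esub> k = \<one>\<^bsub>F\<^esub>" and primitive: "\<And>n::nat. 0 < n \<Longrightarrow> n < k \<Longrightarrow> \<phi> [^]\<^bsub>F\<^esub> n \<noteq> \<one>\<^bsub>F\<^esub>"
    using pow1 by (auto dest: dvd_imp_le)
  have sub\<Phi>: "subgroup \<Phi> (mult_of F)"
    unfolding assms(11) using \<phi>G by (intro G.generate_is_subgroup) auto
  note \<Phi>' = F.subgroup_mult_of_facts[OF sub\<Phi>]
  have card\<Phi>: "card \<Phi> = k" using G.generate_pow_card[OF \<phi>G] ord_\<phi> assms(11) by simp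
  have fin\<Phi>: "finite \<Phi>" using \<Phi>'(1) finF finite_subset by blast
  have \<Phi>: "\<Phi> = range (\<lambda>n::nat. \<phi> [^]\<^bsub>F\<^esub> n)"
    using G.generate_pow_nat[OF \<phi>G] ord_\<phi> assms(3,11) by (auto simp: nat_pow_mult_of)
  have \<phi>\<Phi>: "\<phi> \<in> \<Phi>" unfolding assms(11) by (auto intro: generate.incl)
  have bound: "inter_number F \<Phi> a c \<le> 2" if c: "c \<noteq> \<zero>\<^bsub>F\<^esub>"
  proof -
    obtain r' and E :: "nat ring" and \<Psi> where E: "field E" "card (carrier E) = p ^ r'"
      "subgroup \<Psi> (mult_of E)" "card \<Psi> = k" "circular E \<Psi>"
      using assms(12) unfolding circular_pair_def by blast
    interpret E: field E by fact
    interpret GE: group "mult_of E" by (rule E.field_mult_group)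
    have "card (carrier E) > 0" using E(2) assms(1) by (simp add: prime_gt_0_nat)
    then have finE: "finite (carrier E)" using card_gt_0_iff by blast
    note \<Psi>' = E.subgroup_mult_of_facts[OF E(3)]
    \<comment> \<open>Lagrange inside \<open>\<Psi>\<close>, viewed as a group of order
      \<open>k\<close>: all its elements are roots of \<open>X^k - 1\<close>, as the conjugation
      lemma requires.\<close>
    have \<Psi>k: "y [^]\<^bsub>E\<^esub> k = \<one>\<^bsub>E\<^esub>" if "y \<in> \<Psi>" for y
    proof -
      interpret S: group "(mult_of E)\<lparr>carrier := \<Psi>\<rparr>"
        using E(3) GE.is_group by (rule subgroup.subgroup_is_group)
      have "y [^]\<^bsub>(mult_of E)\<lparr>carrier := \<Psi>\<rparr>\<^esub> k = \<one>\<^bsub>E\<^esub>"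
        using S.pow_order_eq_1[of y] that E(4) by (simp add: Coset.order_def)
      then show ?thesis
        by (simp add: GE.nat_pow_consistent[symmetric] nat_pow_mult_of)
    qed
    obtain y where "y \<in> \<Psi>" "\<And>P. ipoly_eval F \<phi> P = \<zero>\<^bsub>F\<^esub> \<longleftrightarrow> ipoly_eval E y P = \<zero>\<^bsub>E\<^esub>"
      using conjugate_root_of_unity[OF F.domain_axioms E.domain_axioms finE assms(1)
          F.prime_card_imp_char[OF finF] E.prime_card_imp_char[OF finE E(2)] _ \<phi> k \<Psi>'(1) E(4) \<Psi>k]
        assms(2,3,7) by auto
    then show ?thesis
      using circular_bound_transfer[OF assms(6) E(1) finE E(3,5) _ sub\<Phi> \<Phi> \<phi> _ assms(13,14) c] by blast
  qed
  have pow_inj: "i = j"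
    if "i \<in> {1..int k - 1}" "j \<in> {1..int k - 1}" "\<phi> [^]\<^bsub>F\<^esub> nat i = \<phi> [^]\<^bsub>F\<^esub> nat j" for i j
  proof -
    have "nat i \<in> {0..G.ord \<phi> - 1}" "nat j \<in> {0..G.ord \<phi> - 1}" using that ord_\<phi> by auto
    then have "nat i = nat j"
      using inj_onD[OF G.ord_inj[OF \<phi>G]] that(3) by (simp add: nat_pow_mult_of)
    then show ?thesis using that by auto
  qed
  \<comment> \<open>Exponents from 0 to \<open>k - 1\<close> exhaust \<open>\<Phi>\<close>, and
    exponent 0 gives one; so ratios other than one have exponents in the index range of the
    claim.\<close>
  have rep: "\<exists>i\<in>{1..int k - 1}. X = \<phi> [^]\<^bsub>F\<^esub> nat i" if "X \<in> \<Phi>" "X \<noteq> \<one>\<^bsub>F\<^esub>" for X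
  proof -
    have "\<Phi> = {\<phi> [^]\<^bsub>F\<^esub> x |x. x \<in> {0..k - 1}}"
      using G.ord_elems[OF _ \<phi>G] finF assms(11) ord_\<phi>
      by (simp add: G.generate_pow_on_finite_carrier[OF _ \<phi>G] nat_pow_mult_of)
    with that obtain n where n: "n \<le> k - 1" "X = \<phi> [^]\<^bsub>F\<^esub> n" by auto
    moreover have "n \<noteq> 0" using n that \<phi> by (intro notI) simp
    ultimately show ?thesis using assms(3) by (intro bexI[of _ "int n"]) auto
  qed
  have not1: "\<phi> [^]\<^bsub>F\<^esub> nat i \<noteq> \<one>\<^bsub>F\<^esub>" if "i \<in> {1..int k - 1}" for i
    using that by (intro primitive) auto
  have powH: "\<phi> [^]\<^bsub>F\<^esub> nat i \<in> \<Phi>" for i using \<Phi>'(5) \<phi>\<Phi> by blast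
  define A where "A X Y \<longleftrightarrow> (\<exists>u\<in>\<Phi>. a \<otimes>\<^bsub>F\<^esub> (Y \<ominus>\<^bsub>F\<^esub> \<one>\<^bsub>F\<^esub>) = u \<otimes>\<^bsub>F\<^esub> (X \<ominus>\<^bsub>F\<^esub> \<one>\<^bsub>F\<^esub>)) \<and>
    (\<exists>t\<in>\<Phi>. c \<otimes>\<^bsub>F\<^esub> (Y \<ominus>\<^bsub>F\<^esub> \<one>\<^bsub>F\<^esub>) = t \<otimes>\<^bsub>F\<^esub> (Y \<ominus>\<^bsub>F\<^esub> X))" for X Y
  \<comment> \<open>\<open>k \<ge> 3\<close> supplies the condition
    \<open>card \<Phi> \<noteq> 2\<close>. With \<open>A\<close> kept folded, the next step only
    exchanges ratios for exponents.\<close>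
  have "inter_number F \<Phi> a c = 2 \<longleftrightarrow>
    (\<exists>X\<in>\<Phi>. \<exists>Y\<in>\<Phi>. X \<noteq> \<one>\<^bsub>F\<^esub> \<and> Y \<noteq> \<one>\<^bsub>F\<^esub> \<and> X \<noteq> Y \<and> A X Y)"
    unfolding A_def using assms(3) card\<Phi>
    by (intro F.inter_number_eq_2_iff_ratios sub\<Phi> fin\<Phi> assms(13-15) bound) auto
  also have "\<dots> \<longleftrightarrow> (\<exists>i \<in> {1..int k - 1}. \<exists>j \<in> {1..int k - 1}. i \<noteq> j \<and>
      A (\<phi> [^]\<^bsub>F\<^esub> nat i) (\<phi> [^]\<^bsub>F\<^esub> nat j))" (is "?L \<longleftrightarrow> ?R")
  proof
    assume ?L
    then obtain X Y where XY: "X \<in> \<Phi>" "Y \<in> \<Phi>" "X \<noteq> \<one>\<^bsub>F\<^esub>" "Y \<noteq> \<one>\<^bsub>F\<^esub>" "X \<noteq> Y" "A X Y" by blast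
    obtain i j where ij: "i \<in> {1..int k - 1}" "X = \<phi> [^]\<^bsub>F\<^esub> nat i" "j \<in> {1..int k - 1}" "Y = \<phi> [^]\<^bsub>F\<^esub> nat j"
      using rep XY(1-4) by metis
    with XY(5) have "i \<noteq> j" by blast
    with ij XY(6) show ?R by blast
  next
    assume ?R
    then obtain i j where ij: "i \<in> {1..int k - 1}" "j \<in> {1..int k - 1}" "i \<noteq> j"
      "A (\<phi> [^]\<^bsub>F\<^esub> nat i) (\<phi> [^]\<^bsub>F\<^esub> nat j)" by blast
    then show ?L using pow_inj[OF ij(1,2)] not1[OF ij(1)] not1[OF ij(2)] powH by blast
  qed
  also have "\<dots> \<longleftrightarrow> (\<exists>i \<in> {1..int k - 1}. \<exists>j \<in> {1..int k - 1}. i \<noteq> j \<and>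
       a \<in> \<Phi> #>\<^bsub>F\<^esub> c_elem F k \<phi> j i \<and>
       c \<in> \<Phi> #>\<^bsub>F\<^esub> c_elem F k \<phi> j (j - i))"
    unfolding A_def by (intro bex_cong refl conj_cong)
      (simp_all only: F.c_elem_coset_iff[OF k primitive sub\<Phi> \<phi>\<Phi> assms(13,14)])
  finally show ?thesis .
qed

end
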